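(* Let $(a_n)_{n\ge1}$ be an E-sequence such that (i) $3^n>2^{b_n}$ for all $n\ge1$, where $b_n=\sum_{i=1}^na_i$; and (ii) there is a constant $c>\log_2 3$ such that there are infinitely many distinct pairs $(k,l)$ of positive integers with $l>kc$ and $a_{k+1}=\cdots=a_l=1$. Then $(a_n)$ is $\Omega$-divergent.
   Context: An E-sequence is any infinite sequence $(a_n)_{n\ge1}$ of positive integers. For an odd positive integer $x$, its E-sequence is defined by $x_0=x$ and, for $n\ge1$, $x_n=\frac{3x_{n-1}+1}{2^{a_n}}$, where $a_n$ is the exponent of the largest power of $2$ dividing $3x_{n-1}+1$. An E-sequence is $\Omega$-divergent if it is not the E-sequence of any odd positive integer. *)

theory Defs
  imports Complex_Main "HOL-Computational_Algebra.Primes"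
begin

(* Sequences are indexed from 1; the value at index 0 is never referred to. *)

definition E_sequence :: "(nat \<Rightarrow> nat) \<Rightarrow> bool" where
  "E_sequence a \<longleftrightarrow> (\<forall>n\<ge>1. a n > 0)"

(* The division is exact, see E_orbit_Suc_real. *)

primrec E_orbit :: "nat \<Rightarrow> nat \<Rightarrow> nat" where
  "E_orbit x 0 = x"
| "E_orbit x (Suc n) =
     (3 * E_orbit x n + 1) div 2 ^ multiplicity 2 (3 * E_orbit x n + 1)"

lemma E_orbit_Suc_real:
  "real (E_orbit x (Suc n)) =
     (3 * real (E_orbit x n) + 1) / 2 ^ multiplicity 2 (3 * E_orbit x n + 1)"
proof -
  have "2 ^ multiplicity 2 (3 * E_orbit x n + 1) dvd 3 * E_orbit x n + 1"
    by (rule multiplicity_dvd)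
  then show ?thesis
    by (simp add: real_of_nat_div)
qed

definition is_E_sequence_of :: "(nat \<Rightarrow> nat) \<Rightarrow> nat \<Rightarrow> bool" where
  "is_E_sequence_of a x \<longleftrightarrow>
     (\<forall>n\<ge>1. a n = multiplicity 2 (3 * E_orbit x (n - 1) + 1))"

definition Omega_divergent :: "(nat \<Rightarrow> nat) \<Rightarrow> bool" where
  "Omega_divergent a \<longleftrightarrow>
     E_sequence a \<and> \<not> (\<exists>x. odd x \<and> x > 0 \<and> is_E_sequence_of a x)"

end

theory Submission
  imports Defs "HOL-Real_Asymp.Real_Asymp"
begin

text \<open>
  Suppose \<open>a\<close> is the E-sequence of \<open>x\<close>, with orbit \<open>x\<^sub>n\<close>. Condition (i) gives
  \<open>2\<^bsup>b\<^sub>n\<^esup> x\<^sub>n \<le> 3\<^sup>n (x + n)\<close>. A run of ones from \<open>k + 1\<close> to \<open>l\<close> multiplies \<open>x\<^sub>k + 1\<close> by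
  \<open>(3/2)\<^bsup>l-k\<^esup>\<close>, so \<open>2\<^bsup>l-k\<^esup>\<close> divides \<open>x\<^sub>k + 1\<close>. Together, \<open>2\<^sup>l \<le> 3\<^sup>k (x + k + 1)\<close>. If \<open>l > k c\<close>
  this yields \<open>(2\<^sup>c/3)\<^sup>k < x + k + 1\<close> with \<open>2\<^sup>c/3 > 1\<close>, which bounds \<open>k\<close>, and then \<open>l\<close>.
\<close>

lemma E_orbit_step:
  assumes "is_E_sequence_of a x"
  shows "2 ^ a (Suc n) * E_orbit x (Suc n) = 3 * E_orbit x n + 1"
proof -
  have "a (Suc n) = multiplicity 2 (3 * E_orbit x n + 1)"
    using assms unfolding is_E_sequence_of_def by (metis diff_Suc_1 le_add1 plus_1_eq_Suc)
  then show ?thesis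
    using multiplicity_dvd[of 2 "3 * E_orbit x n + 1"]
    by (simp only: E_orbit.simps dvd_mult_div_cancel)
qed

text \<open>Passing from \<open>n\<close> to \<open>Suc n\<close>, the product
  \<open>2 ^ b\<^sub>n * x\<^sub>n\<close> triples and gains \<open>2 ^ b\<^sub>n\<close>, which is
  at most \<open>3 ^ n\<close>. The bound leaves room for a gain of
  \<open>3 ^ Suc n\<close>.\<close>

lemma E_orbit_upper_bound:
  assumes "is_E_sequence_of a x"
    and "\<And>n. 2 ^ (\<Sum>i=1..n. a i) \<le> (3::nat) ^ n"
  shows "2 ^ (\<Sum>i=1..n. a i) * E_orbit x n \<le> 3 ^ n * (x + n)"
proof (induction n)
  case 0
  then show ?case by simp
next
  case (Suc n)
  let ?p = "2 ^ (\<Sum>i=1..n. a i) :: nat"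
  have "2 ^ (\<Sum>i=1..Suc n. a i) * E_orbit x (Suc n) = ?p * (2 ^ a (Suc n) * E_orbit x (Suc n))"
    by (simp add: power_add del: E_orbit.simps)
  also have "\<dots> = 3 * (?p * E_orbit x n) + ?p"
    unfolding E_orbit_step[OF assms(1)] by (simp add: algebra_simps)
  also have "\<dots> \<le> 3 * (3 ^ n * (x + n)) + 3 ^ n"
    using Suc.IH assms(2)[of n] by linarith
  also have "\<dots> \<le> 3 ^ Suc n * (x + Suc n)"
    by (simp add: algebra_simps)
  finally show ?case .
qed

text \<open>While \<open>a i = 1\<close>, the step is \<open>y \<mapsto> (3 * y + 1) / 2\<close>,
  whose fixed point is -1; shifting by 1 turns it into multiplication by 3/2.\<close>

lemma E_orbit_run_of_ones:
  assumes "is_E_sequence_of a x" and "\<forall>i\<in>{k+1..k+j}. a i = 1"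
  shows "2 ^ j * (E_orbit x (k + j) + 1) = 3 ^ j * (E_orbit x k + 1)"
  using assms(2)
proof (induction j)
  case 0
  then show ?case by simp
next
  case (Suc j)
  have "2 * E_orbit x (Suc (k + j)) = 3 * E_orbit x (k + j) + 1"
    using E_orbit_step[OF assms(1), of "k + j"] Suc.prems by simp
  then have "2 * (E_orbit x (k + Suc j) + 1) = 3 * (E_orbit x (k + j) + 1)"
    by (simp del: E_orbit.simps)
  then have "2 ^ Suc j * (E_orbit x (k + Suc j) + 1) = 3 * (2 ^ j * (E_orbit x (k + j) + 1))"
    by (metis (no_types, lifting) mult.assoc mult.left_commute power_Suc)
  also have "\<dots> = 3 * (3 ^ j * (E_orbit x k + 1))"
    using Suc by simp
  finally show ?case by simp
qed

lemma E_orbit_run_of_ones_lower_bound: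
  assumes "is_E_sequence_of a x" and "\<forall>i\<in>{k+1..k+j}. a i = 1"
  shows "2 ^ j \<le> E_orbit x k + 1"
proof -
  have "(2::nat) ^ j dvd 3 ^ j * (E_orbit x k + 1)"
    by (metis E_orbit_run_of_ones[OF assms] dvd_triv_left)
  moreover have "coprime ((2::nat) ^ j) (3 ^ j)"
    by simp
  ultimately have "2 ^ j dvd E_orbit x k + 1"
    by (simp only: coprime_dvd_mult_right_iff)
  then show ?thesis
    by (rule dvd_imp_le) simp
qed

theorem theorem4p11:
  fixes a :: "nat \<Rightarrow> nat" and b :: "nat \<Rightarrow> nat"
  assumes "E_sequence a"
    and "\<And>n. b n = (\<Sum>i=1..n. a i)"
    and "\<And>n. n \<ge> 1 \<Longrightarrow> (3::nat) ^ n > 2 ^ b n"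
    and "\<exists>c::real. c > log 2 3 \<and>
           infinite {(k::nat, l::nat). k > 0 \<and> l > 0 \<and> real l > real k * c \<and>
             (\<forall>i\<in>{k+1..l}. a i = 1)}"
  shows "Omega_divergent a"
proof -
  have False if ex: "is_E_sequence_of a x" for x
  proof -
    obtain c :: real where c: "c > log 2 3"
      and inf: "infinite {(k::nat, l::nat). k > 0 \<and> l > 0 \<and> real l > real k * c \<and>
             (\<forall>i\<in>{k+1..l}. a i = 1)}" (is "infinite ?S")
      using assms(4) by blast
    \<comment> \<open>Condition (i) is strict but starts at \<open>n = 1\<close>; the weak form also
      covers \<open>n = 0\<close>, where both sides are 1.\<close>
    have pow: "2 ^ (\<Sum>i=1..n. a i) \<le> (3::nat) ^ n" for n
      using assms(3)[of n] assms(2)[of n] by (cases n) auto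
    have b_ge: "k \<le> (\<Sum>i=1..k. a i)" for k
      using sum_mono[of "{1..k}" "\<lambda>_. 1" a] assms(1) by (force simp: E_sequence_def)
    \<comment> \<open>\<open>c > 1\<close> ensures \<open>k \<le> l\<close>, so that the natural
      subtraction \<open>l - k\<close> below is exact.\<close>
    have "log 2 3 > (1::real)"
      by simp
    with c have c1: "c > 1"
      by linarith
    have bound: "2 ^ l \<le> 3 ^ k * (x + k + 1)" if "(k, l) \<in> ?S" for k l
    proof -
      have "real k * 1 \<le> real k * c"
        using c1 by (intro mult_left_mono) auto
      also have "\<dots> < real l"
        using that by simp
      finally have kl: "k \<le> l"
        by simp
      have "2 ^ l = (2::nat) ^ k * 2 ^ (l - k)"
        using kl by (simp flip: power_add)
      also have "\<dots> \<le> 2 ^ k * (E_orbit x k + 1)"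
        using that kl by (intro mult_left_mono E_orbit_run_of_ones_lower_bound[OF ex]) auto
      \<comment> \<open>Raising the exponent from \<open>k\<close> to \<open>b k\<close> makes
        \<open>E_orbit_upper_bound\<close> applicable; the summand 1 then costs
        \<open>2 ^ b k \<le> 3 ^ k\<close>.\<close>
      also have "\<dots> \<le> 2 ^ (\<Sum>i=1..k. a i) * (E_orbit x k + 1)"
        using b_ge[of k] by (intro mult_right_mono power_increasing) auto
      also have "\<dots> \<le> 3 ^ k * (x + k) + 3 ^ k"
        using E_orbit_upper_bound[OF ex pow, of k] pow[of k] by simp
      finally show "2 ^ l \<le> 3 ^ k * (x + k + 1)"
        by (simp add: algebra_simps)
    qed
    define q where "q = 2 powr c / (3::real)"
    have "2 powr log 2 3 < 2 powr c"
      using c by (intro powr_less_mono) auto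
    then have q: "q > 1"
      by (simp add: q_def)
    \<comment> \<open>Exponential growth beats linear growth, which supplies the cutoff
      \<open>K\<close> for \<open>k\<close>.\<close>
    have "eventually (\<lambda>k. real x + real k + 1 < q ^ k) sequentially"
      using q by real_asymp
    then obtain K where K: "real x + real k + 1 < q ^ k" if "k \<ge> K" for k
      unfolding eventually_sequentially by blast
    have "?S \<subseteq> (SIGMA k:{..<K}. {..3 ^ k * (x + k + 1)})"
    proof (rule subrelI)
      fix k l :: nat
      assume kl: "(k, l) \<in> ?S"
      note le = bound[OF kl]
      \<comment> \<open>Since \<open>l < 2 ^ l\<close>, the bound on \<open>2 ^ l\<close> leaves
        finitely many \<open>l\<close> for each \<open>k\<close>.\<close>
      have l: "l \<in> {..3 ^ k * (x + k + 1)}"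
        using le less_exp[of l] unfolding atMost_iff by linarith
      have "3 ^ k * q ^ k = 2 powr (real k * c)"
        by (simp add: q_def power_divide powr_power mult.commute)
      also have "\<dots> \<le> 2 powr real l"
        using kl by (intro powr_mono) auto
      also have "\<dots> = real (2 ^ l)"
        by (simp add: powr_realpow)
      also have "\<dots> \<le> real (3 ^ k * (x + k + 1))"
        using le by (rule of_nat_mono)
      also have "\<dots> = 3 ^ k * (real x + real k + 1)"
        by (simp add: algebra_simps)
      finally have "q ^ k \<le> real x + real k + 1"
        by (rule mult_left_le_imp_le) simp
      then have "k \<in> {..<K}"
        using K[of k] by (meson lessThan_iff linorder_not_less)
      then show "(k, l) \<in> (SIGMA k:{..<K}. {..3 ^ k * (x + k + 1)})"
        using l by (rule SigmaI)
    qed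
    then have "finite ?S"
      by (rule finite_subset) auto
    with inf show False
      by simp
  qed
  with assms(1) show ?thesis
    by (auto simp: Omega_divergent_def)
qed

end
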